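(* If $G$ is a graph with maximum degree at most $5$, then $\mathrm{def}_c(G)\le|V(G)|$.
   Context: All graphs are finite, simple and undirected. A set $A\subseteq\{1,\dots,t\}$ is a cyclic interval modulo $t$ if $A$ or $\{1,\dots,t\}\setminus A$ is an interval of integers; a cyclic interval $t$-coloring is a proper edge coloring with colors $1,\dots,t$ in which the set of colors at every vertex is a cyclic interval modulo $t$. The cyclic deficiency $\mathrm{def}_c(G)$ is the minimum number of pendant edges whose attachment to $G$ yields a graph admitting a cyclic interval coloring; equivalently, it is the minimum over proper edge colorings $\alpha$ of $G$ with colors $1,\dots,t$ (any $t$) of $\sum_v$ (the minimum number of positive integers whose addition to the set of colors at $v$ makes it a cyclic interval modulo $t$). *)

theory Defs
  imports Main
begin

definition simple_graph :: "'a set \<Rightarrow> 'a set set \<Rightarrow> bool" where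
  "simple_graph V E \<longleftrightarrow> finite V \<and> (\<forall>e\<in>E. e \<subseteq> V \<and> card e = 2)"

definition degree :: "'a set set \<Rightarrow> 'a \<Rightarrow> nat" where
  "degree E v = card {e \<in> E. v \<in> e}"

(* The inserted 0 only matters for the graph without vertices. *)
definition max_degree :: "'a set \<Rightarrow> 'a set set \<Rightarrow> nat" where
  "max_degree V E = Max (insert 0 (degree E ` V))"

(* The empty set is an interval, as {a..b} with b < a. *)
definition is_interval_nat :: "nat set \<Rightarrow> bool" where
  "is_interval_nat A \<longleftrightarrow> (\<exists>a b. A = {a..b})"

definition cyclic_interval :: "nat \<Rightarrow> nat set \<Rightarrow> bool" where
  "cyclic_interval t A \<longleftrightarrow>
     A \<subseteq> {1..t} \<and> (is_interval_nat A \<or> is_interval_nat ({1..t} - A))"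

(* Not every colour in {1..t} has to be used. *)
definition proper_edge_coloring :: "'a set set \<Rightarrow> nat \<Rightarrow> ('a set \<Rightarrow> nat) \<Rightarrow> bool" where
  "proper_edge_coloring E t \<alpha> \<longleftrightarrow>
     (\<forall>e\<in>E. \<alpha> e \<in> {1..t}) \<and>
     (\<forall>e\<in>E. \<forall>e'\<in>E. e \<noteq> e' \<and> e \<inter> e' \<noteq> {} \<longrightarrow> \<alpha> e \<noteq> \<alpha> e')"

definition colors_at :: "'a set set \<Rightarrow> ('a set \<Rightarrow> nat) \<Rightarrow> 'a \<Rightarrow> nat set" where
  "colors_at E \<alpha> v = \<alpha> ` {e \<in> E. v \<in> e}"

definition cyclic_interval_coloring ::
    "'a set \<Rightarrow> 'a set set \<Rightarrow> nat \<Rightarrow> ('a set \<Rightarrow> nat) \<Rightarrow> bool" where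
  "cyclic_interval_coloring V E t \<alpha> \<longleftrightarrow>
     proper_edge_coloring E t \<alpha> \<and> (\<forall>v\<in>V. cyclic_interval t (colors_at E \<alpha> v))"

definition cyclically_interval_colorable :: "'a set \<Rightarrow> 'a set set \<Rightarrow> bool" where
  "cyclically_interval_colorable V E \<longleftrightarrow> (\<exists>t\<ge>1. \<exists>\<alpha>. cyclic_interval_coloring V E t \<alpha>)"

(* Attaching k pendant edges: the i-th one joins the old vertex f i to a new leaf Inr i.
   The sum type guarantees that the k leaves are fresh and pairwise distinct. *)
definition attach_verts :: "'a set \<Rightarrow> nat \<Rightarrow> ('a + nat) set" where
  "attach_verts V k = Inl ` V \<union> Inr ` {..<k}"

definition attach_edges :: "'a set set \<Rightarrow> nat \<Rightarrow> (nat \<Rightarrow> 'a) \<Rightarrow> ('a + nat) set set" where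
  "attach_edges E k f = (\<lambda>e. Inl ` e) ` E \<union> (\<lambda>i. {Inl (f i), Inr i}) ` {..<k}"

definition cyclic_deficiency :: "'a set \<Rightarrow> 'a set set \<Rightarrow> nat" where
  "cyclic_deficiency V E =
     (LEAST k. \<exists>f. f ` {..<k} \<subseteq> V \<and>
        cyclically_interval_colorable (attach_verts V k) (attach_edges E k f))"

lemma simple_graph_attach:
  assumes "simple_graph V E" and "f ` {..<k} \<subseteq> V"
  shows "simple_graph (attach_verts V k) (attach_edges E k f)"
  using assms
  by (fastforce simp: simple_graph_def attach_verts_def attach_edges_def card_image card_insert_if)

end

theory Submission
  imports Defs "HOL-Combinatorics.Transposition"
begin

text \<open>By Vizing's theorem the graph has a proper coloring with 6 colors. Placing the colors on a
  6-cycle in random order, a set of colors is on average at most 4/5 elements short of a cyclic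
  interval modulo 6, so some placement needs at most one pendant edge per vertex on average.

  Vizing's theorem is proved by adding vertices one at a time. To add v, two colors missing at each
  neighbor are reserved (only one at a single neighbor). Kempe swaps make the numbers of
  neighbors holding each color differ by at most 2, and as the total is odd and smaller than twice
  the number of colors, some color is held by exactly one neighbor.\<close>

section \<open>Kempe components\<close>

lemma exit_pair:
  assumes "r\<^sup>*\<^sup>* x y" "x \<in> S" "y \<notin> S"
  obtains p q where "p \<in> S" "q \<notin> S" "r p q"
  using assms by (induction) auto

text \<open>Read as a graph, \<open>r\<close> has degree at most two, so a component is a path or a
  cycle and has at most two ends. Instead of building the path, the proof takes a maximal set S that
  contains x, avoids y and z, and has at most one pair of \<open>r\<close> leading out of
  it.\<close>

lemma no_three_ends:
  assumes sym: "\<And>a b. r a b \<Longrightarrow> r b a"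
    and fin: "finite F" and F: "\<And>a b. r a b \<Longrightarrow> b \<in> F"
    and two: "\<And>a b c d. r a b \<Longrightarrow> r a c \<Longrightarrow> r a d \<Longrightarrow> b = c \<or> c = d \<or> b = d"
    and ends: "\<And>a b c. a \<in> {x, y, z} \<Longrightarrow> r a b \<Longrightarrow> r a c \<Longrightarrow> b = c"
    and dist: "x \<noteq> y" "x \<noteq> z" "y \<noteq> z"
    and reach: "r\<^sup>*\<^sup>* x y" "r\<^sup>*\<^sup>* x z"
  shows False
proof -
  define good where "good S \<longleftrightarrow> x \<in> S \<and> S \<subseteq> insert x F \<and> y \<notin> S \<and> z \<notin> S \<and>
    (\<forall>p q p' q'. p \<in> S \<longrightarrow> q \<notin> S \<longrightarrow> r p q \<longrightarrow> p' \<in> S \<longrightarrow> q' \<notin> S \<longrightarrow> r p' q' \<longrightarrow> p = p' \<and> q = q')" for S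
  have fg: "finite {S. good S}"
    by (rule finite_subset[of _ "Pow (insert x F)"]) (auto simp: good_def fin)
  have "good {x}"
    using dist ends[of x] by (auto simp: good_def)
  then have "{S. good S} \<noteq> {}" by blast
  from finite_has_maximal[OF fg this] obtain S
    where S: "good S" and max: "\<And>T. good T \<Longrightarrow> S \<subseteq> T \<Longrightarrow> T = S" by blast
  have xS: "x \<in> S" and yS: "y \<notin> S" and zS: "z \<notin> S" and SF: "S \<subseteq> insert x F"
    using S by (auto simp: good_def)
  obtain p q where pq: "p \<in> S" "q \<notin> S" "r p q"
    using exit_pair[OF reach(1) xS yS] .
  have uniq: "p' = p \<and> q' = q" if "p' \<in> S" "q' \<notin> S" "r p' q'" for p' q'
    using S pq that unfolding good_def by blast
  \<comment> \<open>At an end q the only neighbor is p, so adding q to S leaves no way out, although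
    w is still reachable from x.\<close>
  have closed: False if "q \<in> {x, y, z}" "w \<in> {y, z}" "w \<noteq> q" for w
  proof -
    have "r\<^sup>*\<^sup>* x w" "x \<in> insert q S" "w \<notin> insert q S"
      using reach xS yS zS that by auto
    then obtain p' q' where p': "p' \<in> insert q S" "q' \<notin> insert q S" "r p' q'"
      by (rule exit_pair)
    then have "p' = q" using uniq by blast
    then have "q' = p" using p' ends[OF that(1), of q' p] sym[OF pq(3)] by blast
    then show False using p' pq by blast
  qed
  show False
  proof (cases "q \<in> {y, z}")
    case True
    then show False using closed[of y] closed[of z] dist by blast
  next
    case False
    \<comment> \<open>Since q has the neighbor p inside S, it has at most one outside, so S can grow
      by q.\<close>
    have "good (insert q S)"
      unfolding good_def
    proof (intro conjI allI impI)
      show "insert q S \<subseteq> insert x F" using SF F[OF pq(3)] by blast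
      fix p1 q1 p2 q2
      assume *: "p1 \<in> insert q S" "q1 \<notin> insert q S" "r p1 q1"
        "p2 \<in> insert q S" "q2 \<notin> insert q S" "r p2 q2"
      then have "p1 = q" "p2 = q" using uniq by blast+
      moreover from this have "q1 = q2"
        using two[of q p q1 q2] sym[OF pq(3)] * pq by blast
      ultimately show "p1 = p2" "q1 = q2" by auto
    qed (use xS yS zS False in auto)
    then show False using max[of "insert q S"] pq by blast
  qed
qed

section \<open>Vizing's theorem\<close>

text \<open>Colors come from an arbitrary set K instead of an initial segment, so that an induction
  can put a single color aside.\<close>

definition edge_coloring :: "'a set set \<Rightarrow> nat set \<Rightarrow> ('a set \<Rightarrow> nat) \<Rightarrow> bool" where
  "edge_coloring E K c \<longleftrightarrow> c ` E \<subseteq> K \<and> (\<forall>v. inj_on c {e \<in> E. v \<in> e})"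

text \<open>Touching C is a sufficient test: in the lemmas below, C is closed along edges of color i
  or j, so such an edge that meets C lies inside it, and every other color is fixed by the
  transposition.\<close>

definition kempe_swap :: "nat \<Rightarrow> nat \<Rightarrow> 'a set \<Rightarrow> ('a set \<Rightarrow> nat) \<Rightarrow> 'a set \<Rightarrow> nat" where
  "kempe_swap i j C c e = (if e \<inter> C \<noteq> {} then transpose i j (c e) else c e)"

lemma kempe_swap_at:
  assumes "\<And>e. e \<in> E \<Longrightarrow> c e \<in> {i, j} \<Longrightarrow> e \<inter> C \<noteq> {} \<Longrightarrow> e \<subseteq> C" "e \<in> E" "v \<in> e"
  shows "kempe_swap i j C c e = (if v \<in> C then transpose i j (c e) else c e)"
proof (cases "c e \<in> {i, j}")
  case True
  then show ?thesis using assms(1)[OF assms(2) True] assms(3) by (auto simp: kempe_swap_def)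
next
  case False
  then show ?thesis by (auto simp: kempe_swap_def)
qed

lemma colors_at_kempe_swap:
  assumes "\<And>e. e \<in> E \<Longrightarrow> c e \<in> {i, j} \<Longrightarrow> e \<inter> C \<noteq> {} \<Longrightarrow> e \<subseteq> C"
  shows "colors_at E (kempe_swap i j C c) v =
    (if v \<in> C then transpose i j ` colors_at E c v else colors_at E c v)"
proof -
  have "kempe_swap i j C c ` {e \<in> E. v \<in> e} =
      (\<lambda>e. if v \<in> C then transpose i j (c e) else c e) ` {e \<in> E. v \<in> e}"
    using kempe_swap_at[of E c i j C, OF assms] by (intro image_cong) auto
  then show ?thesis by (simp add: colors_at_def image_image)
qed

lemma edge_coloring_kempe_swap:
  assumes "edge_coloring E K c" "i \<in> K" "j \<in> K"
    and closed: "\<And>e. e \<in> E \<Longrightarrow> c e \<in> {i, j} \<Longrightarrow> e \<inter> C \<noteq> {} \<Longrightarrow> e \<subseteq> C"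
  shows "edge_coloring E K (kempe_swap i j C c)"
  unfolding edge_coloring_def
proof (intro conjI allI)
  show "kempe_swap i j C c ` E \<subseteq> K"
    using assms(1-3) by (auto simp: edge_coloring_def kempe_swap_def transpose_def)
  show "inj_on (kempe_swap i j C c) {e \<in> E. v \<in> e}" for v
  proof (rule inj_onI)
    fix e e' assume *: "e \<in> {e \<in> E. v \<in> e}" "e' \<in> {e \<in> E. v \<in> e}"
      "kempe_swap i j C c e = kempe_swap i j C c e'"
    then have "c e = c e'"
      using kempe_swap_at[of E c i j C, OF closed, of _ v]
      by (auto split: if_splits dest: injD[OF inj_transpose])
    then show "e = e'"
      using assms(1) * unfolding edge_coloring_def inj_on_def by blast
  qed
qed

section \<open>Balancing the reserved colors by Kempe swaps\<close>

definition palette :: "'a set set \<Rightarrow> nat set \<Rightarrow> 'a set \<Rightarrow> ('a \<Rightarrow> nat) \<Rightarrow>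
    ('a set \<Rightarrow> nat) \<times> ('a \<Rightarrow> nat set) \<Rightarrow> bool" where
  "palette E K N d = (\<lambda>(c, P). edge_coloring E K c \<and>
     (\<forall>w\<in>N. P w \<subseteq> K - colors_at E c w \<and> card (P w) = d w))"

definition holders :: "'a set \<Rightarrow> ('a \<Rightarrow> nat set) \<Rightarrow> nat \<Rightarrow> 'a set" where
  "holders N P i = {w \<in> N. i \<in> P w}"

text \<open>In a palette the holder counts have a fixed sum, determined by d, so the sum of their
  squares measures how unevenly the reserved colors are spread.\<close>

definition imbalance :: "nat set \<Rightarrow> 'a set \<Rightarrow> ('a set \<Rightarrow> nat) \<times> ('a \<Rightarrow> nat set) \<Rightarrow> nat" where
  "imbalance K N = (\<lambda>(c, P). \<Sum>i\<in>K. (card (holders N P i))\<^sup>2)"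

text \<open>Transposing i and j in the reserved sets inside C, along with the colors of the edges,
  keeps these sets disjoint from the colors present and of the same size.\<close>

lemma palette_swap:
  assumes "palette E K N d (c, P)" "i \<in> K" "j \<in> K"
    and closed: "\<And>e. e \<in> E \<Longrightarrow> c e \<in> {i, j} \<Longrightarrow> e \<inter> C \<noteq> {} \<Longrightarrow> e \<subseteq> C"
  shows "palette E K N d
    (kempe_swap i j C c, \<lambda>w. if w \<in> C then transpose i j ` P w else P w)"
proof -
  have c: "edge_coloring E K c"
    and P: "\<And>w. w \<in> N \<Longrightarrow> P w \<subseteq> K" "\<And>w. w \<in> N \<Longrightarrow> P w \<inter> colors_at E c w = {}"
      "\<And>w. w \<in> N \<Longrightarrow> card (P w) = d w"
    using assms(1) by (auto simp: palette_def)
  have "(if w \<in> C then transpose i j ` P w else P w)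
      \<subseteq> K - colors_at E (kempe_swap i j C c) w \<and>
      card (if w \<in> C then transpose i j ` P w else P w) = d w" if "w \<in> N" for w
  proof (cases "w \<in> C")
    case True
    have "transpose i j ` P w \<subseteq> K"
      using P(1)[OF that] assms(2,3) by (auto simp: transpose_def)
    moreover have "transpose i j ` P w \<inter> transpose i j ` colors_at E c w = {}"
      using P(2)[OF that] by (metis image_Int inj_transpose image_empty)
    moreover have "card (transpose i j ` P w) = d w"
      using P(3)[OF that] by (simp add: card_image)
    ultimately show ?thesis
      using True colors_at_kempe_swap[of E c i j C w, OF closed] by auto
  next
    case False
    then show ?thesis
      using P[OF that] colors_at_kempe_swap[of E c i j C w, OF closed] by auto
  qed
  then show ?thesis
    using edge_coloring_kempe_swap[of E K c i j C, OF c assms(2,3) closed]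
    by (simp add: palette_def)
qed

text \<open>Each vertex of A and B misses i or j, so it has at most one edge of these colors, and a
  component contains at most two such vertices. If every vertex of A were connected to one of B,
  choosing such a partner would be injective, against \<open>card B < card A\<close>. Hence the
  component of some vertex of A avoids B.\<close>

lemma kempe_component:
  assumes E: "finite E" "\<And>e. e \<in> E \<Longrightarrow> card e = 2" and c: "edge_coloring E K c"
    and AB: "\<And>w. w \<in> A \<union> B \<Longrightarrow> i \<notin> colors_at E c w \<or> j \<notin> colors_at E c w"
    and disj: "A \<inter> B = {}" and fin: "finite A" "finite B" and less: "card B < card A"
  obtains C where "\<And>e. e \<in> E \<Longrightarrow> c e \<in> {i, j} \<Longrightarrow> e \<inter> C \<noteq> {} \<Longrightarrow> e \<subseteq> C"
    "C \<inter> B = {}" "C \<inter> A \<noteq> {}" "card (C \<inter> A) \<le> 2"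
proof -
  define r where "r y z \<longleftrightarrow> {y, z} \<in> E \<and> c {y, z} \<in> {i, j}" for y z
  have sym: "r z y" if "r y z" for y z
    using that by (simp add: r_def insert_commute)
  have inj: "y = z" if "r x y" "r x z" "c {x, y} = c {x, z}" for x y z
  proof -
    have "{x, y} = {x, z}"
      using c that unfolding edge_coloring_def inj_on_def r_def by blast
    then show ?thesis by (auto simp: doubleton_eq_iff)
  qed
  have finE: "finite (\<Union>E)"
    using E by (auto intro!: finite_Union) (metis card.infinite zero_neq_numeral)
  have three: False
    if "x \<in> A \<union> B" "y \<in> A \<union> B" "z \<in> A \<union> B" "x \<noteq> y" "x \<noteq> z" "y \<noteq> z" "r\<^sup>*\<^sup>* x y" "r\<^sup>*\<^sup>* x z" for x y z
  proof (rule no_three_ends[of r "\<Union>E" x y z])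
    show "b = c'" if "a \<in> {x, y, z}" "r a b" "r a c'" for a b c'
    proof -
      have "c {a, b} \<in> colors_at E c a" "c {a, c'} \<in> colors_at E c a"
        using that by (auto simp: r_def colors_at_def)
      moreover have "i \<notin> colors_at E c a \<or> j \<notin> colors_at E c a"
        using AB that(1) \<open>x \<in> A \<union> B\<close> \<open>y \<in> A \<union> B\<close> \<open>z \<in> A \<union> B\<close> by blast
      ultimately have "c {a, b} = c {a, c'}"
        using that by (auto simp: r_def)
      then show ?thesis using inj that by blast
    qed
    show "b = c' \<or> c' = d \<or> b = d" if "r a b" "r a c'" "r a d" for a b c' d
    proof -
      have "c {a, b} = c {a, c'} \<or> c {a, c'} = c {a, d} \<or> c {a, b} = c {a, d}"
        using that by (auto simp: r_def)
      then show ?thesis using inj that by blast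
    qed
    show "b \<in> \<Union>E" if "r a b" for a b using that by (auto simp: r_def)
  qed (fact sym finE that)+
  have rsym: "r\<^sup>*\<^sup>* y x" if "r\<^sup>*\<^sup>* x y" for x y
    using that by induction (auto intro: converse_rtranclp_into_rtranclp sym)
  have "\<exists>a\<in>A. \<forall>b\<in>B. \<not> r\<^sup>*\<^sup>* a b"
  proof (rule ccontr)
    assume "\<not> ?thesis"
    then obtain f where f: "\<And>a. a \<in> A \<Longrightarrow> f a \<in> B \<and> r\<^sup>*\<^sup>* a (f a)" by metis
    have "inj_on f A"
    proof (rule inj_onI, rule ccontr)
      fix a a' assume *: "a \<in> A" "a' \<in> A" "f a = f a'" "a \<noteq> a'"
      show False
        by (rule three[of "f a" a a']) (use * f[of a] f[of a'] rsym disj in auto)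
    qed
    moreover have "f ` A \<subseteq> B" using f by blast
    ultimately show False using card_inj_on_le[of f A B] fin less by auto
  qed
  then obtain a where a: "a \<in> A" "\<And>b. b \<in> B \<Longrightarrow> \<not> r\<^sup>*\<^sup>* a b" by blast
  define C where "C = {y. r\<^sup>*\<^sup>* a y}"
  have closed: "e \<subseteq> C" if e: "e \<in> E" "c e \<in> {i, j}" "e \<inter> C \<noteq> {}" for e
  proof -
    obtain y z where yz: "e = {y, z}" using E(2)[OF e(1)] by (meson card_2_iff)
    then have "r y z" "r z y" using e by (auto simp: r_def insert_commute)
    then show ?thesis using e(3) yz
      by (auto simp: C_def intro: rtranclp.rtrancl_into_rtrancl)
  qed
  have "card (C \<inter> A) \<le> 2"
  proof (rule ccontr)
    assume "\<not> ?thesis"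
    moreover have "a \<in> C \<inter> A" using a(1) by (simp add: C_def)
    ultimately have "card (C \<inter> A - {a}) > Suc 0" by simp
    then obtain y z where "y \<in> C \<inter> A - {a}" "z \<in> C \<inter> A - {a}" "y \<noteq> z"
      by (metis card.infinite card_le_Suc0_iff_eq not_less zero_le)
    then show False using three[of a y z] a(1) by (auto simp: C_def)
  qed
  moreover have "a \<in> C \<inter> A" using a by (auto simp: C_def)
  moreover have "C \<inter> B = {}" using a(2) by (auto simp: C_def)
  ultimately show ?thesis using that closed by blast
qed

text \<open>Let A and B be the vertices that hold only i and only j. Reserved colors are missing at
  their vertices, so \<open>kempe_component\<close> applies. The swap moves one or two vertices from
  the holders of i to those of j, which is fewer than the gap of 3, so the sum of squares
  drops.\<close>

lemma imbalance_decreases: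
  assumes E: "finite E" "\<And>e. e \<in> E \<Longrightarrow> card e = 2" and fin: "finite N" "finite K"
    and pal: "palette E K N d (c, P)" and ij: "i \<in> K" "j \<in> K"
    and gap: "card (holders N P j) + 3 \<le> card (holders N P i)"
  obtains c' P' where "palette E K N d (c', P')" "imbalance K N (c', P') < imbalance K N (c, P)"
proof -
  let ?X = "holders N P"
  define A where "A = ?X i - ?X j"
  define B where "B = ?X j - ?X i"
  have finX: "finite (?X k)" for k using fin by (simp add: holders_def)
  have neq: "i \<noteq> j" using gap by auto
  have c: "edge_coloring E K c" using pal by (simp add: palette_def)
  have cA: "card A + card (?X i \<inter> ?X j) = card (?X i)"
    using finX by (simp add: A_def card_Diff_subset_Int card_mono)
  have cB: "card B + card (?X i \<inter> ?X j) = card (?X j)"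
    using finX by (simp add: B_def card_Diff_subset_Int card_mono Int_commute)
  obtain C where closed: "\<And>e. e \<in> E \<Longrightarrow> c e \<in> {i, j} \<Longrightarrow> e \<inter> C \<noteq> {} \<Longrightarrow> e \<subseteq> C"
    and C: "C \<inter> B = {}" "C \<inter> A \<noteq> {}" "card (C \<inter> A) \<le> 2"
  proof (rule kempe_component[OF E c, of A B i j])
    show "i \<notin> colors_at E c w \<or> j \<notin> colors_at E c w" if "w \<in> A \<union> B" for w
      using that pal by (auto simp: A_def B_def holders_def palette_def)
    show "card B < card A" using cA cB gap by linarith
  qed (use finX in \<open>auto simp: A_def B_def\<close>)
  define P' where "P' = (\<lambda>w. if w \<in> C then transpose i j ` P w else P w)"
  let ?Y = "holders N P'"
  let ?D = "C \<inter> A"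
  have mem: "k \<in> transpose i j ` P w \<longleftrightarrow> transpose i j k \<in> P w" for k w
    by (metis image_iff transpose_involutory)
  \<comment> \<open>Vertices of C that hold both colors or neither keep their status, so only
    \<open>C \<inter> A\<close> changes sides.\<close>
  have Yi: "?Y i = ?X i - ?D"
    using C(1) by (auto simp: P'_def holders_def mem A_def B_def)
  have Yj: "?Y j = ?X j \<union> ?D"
    using C(1) by (auto simp: P'_def holders_def mem A_def B_def)
  have Yk: "?Y k = ?X k" if "k \<noteq> i" "k \<noteq> j" for k
    using that by (auto simp: P'_def holders_def mem)
  have finD: "finite ?D" using finX by (auto simp: A_def)
  have D: "card ?D > 0" using C(2) finD by (simp add: card_gt_0_iff)
  have ci: "card (?Y i) + card ?D = card (?X i)"
    unfolding Yi using finX finD card_mono[of "?X i" ?D]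
    by (subst card_Diff_subset) (auto simp: A_def intro!: le_add_diff_inverse2 card_mono)
  have cj: "card (?Y j) = card (?X j) + card ?D"
    unfolding Yj using finX finD by (subst card_Un_disjoint) (auto simp: A_def)
  have split: "(\<Sum>k\<in>K. f k) = f i + f j + (\<Sum>k\<in>K - {i, j}. f k)" for f :: "nat \<Rightarrow> nat"
    using sum.subset_diff[of "{i, j}" K f] fin(2) ij neq by simp
  have "(card (?Y i))\<^sup>2 + (card (?Y j))\<^sup>2 < (card (?X i))\<^sup>2 + (card (?X j))\<^sup>2"
  proof -
    \<comment> \<open>With p holders of i after the swap, q holders of j before it and t vertices
      moved, the drop is 2t(p - q).\<close>
    define p where "p = card (?Y i)"
    define q where "q = card (?X j)"
    define t where "t = card ?D"
    note p_q_t_def = p_def q_def t_def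
    have "p > q" using gap ci C(3) unfolding p_q_t_def by linarith
    then have "t * q < t * p" using D by (simp add: p_q_t_def)
    then have "p\<^sup>2 + (q + t)\<^sup>2 < (p + t)\<^sup>2 + q\<^sup>2"
      by (simp add: power2_sum algebra_simps)
    then show ?thesis using ci cj by (simp add: p_q_t_def)
  qed
  then have "imbalance K N (kempe_swap i j C c, P') < imbalance K N (c, P)"
    by (simp add: imbalance_def split Yk)
  moreover have "palette E K N d (kempe_swap i j C c, P')"
    unfolding P'_def by (rule palette_swap[OF pal ij closed])
  ultimately show ?thesis using that by blast
qed

text \<open>At a minimizer of \<open>imbalance\<close> any two holder counts differ by at most 2.
  Their sum is 2|N| - 1 < 2|K|, so some count is below 2. If no count were 1, that one would be 0,
  all counts would be 0 or 2, and the sum could not be odd.\<close>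

lemma exists_unique_holder:
  assumes E: "finite E" "\<And>e. e \<in> E \<Longrightarrow> card e = 2" and fin: "finite N" "finite K"
    and pal: "palette E K N d x" and card: "card N \<le> card K"
    and w0: "w0 \<in> N" and d: "\<And>w. w \<in> N \<Longrightarrow> d w = (if w = w0 then 1 else 2)"
  obtains c P k u where "palette E K N d (c, P)" "k \<in> K" "holders N P k = {u}"
proof -
  \<comment> \<open>\<open>palette\<close> and \<open>imbalance\<close> act on pairs, so that the
    coloring and the reserved sets vary together here.\<close>
  let ?y = "arg_min (imbalance K N) (palette E K N d)"
  obtain c P where cP: "?y = (c, P)" by (cases ?y)
  have y: "palette E K N d (c, P)"
    using arg_min_natI[of "palette E K N d", OF pal] by (simp only: cP[symmetric])
  have min: "imbalance K N (c, P) \<le> imbalance K N z" if "palette E K N d z" for z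
    using arg_min_nat_le[of "palette E K N d", OF that] by (simp only: cP[symmetric])
  let ?X = "holders N P"
  have balanced: "card (?X i) \<le> card (?X j) + 2" if ij: "i \<in> K" "j \<in> K" for i j
  proof (rule ccontr)
    assume "\<not> ?thesis"
    then have "card (?X j) + 3 \<le> card (?X i)" by simp
    then obtain c' P' where "palette E K N d (c', P')" "imbalance K N (c', P') < imbalance K N (c, P)"
      using imbalance_decreases[OF E fin y ij] by blast
    then show False using min by fastforce
  qed
  have P: "P w \<subseteq> K" "card (P w) = d w" if "w \<in> N" for w
    using y that by (auto simp: palette_def)
  \<comment> \<open>Double counting of the pairs of a color and a vertex that holds it.\<close>
  have "(\<Sum>i\<in>K. card (?X i)) = (\<Sum>i\<in>K. \<Sum>w\<in>N. if i \<in> P w then 1 else 0)"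
    using fin by (simp add: holders_def sum.If_cases Int_def)
  also have "\<dots> = (\<Sum>w\<in>N. \<Sum>i\<in>K. if i \<in> P w then 1 else 0)"
    by (rule sum.swap)
  also have "\<dots> = (\<Sum>w\<in>N. d w)"
    using P fin by (intro sum.cong refl) (simp add: sum.If_cases Int_absorb1)
  also have "\<dots> = 1 + (\<Sum>w\<in>N - {w0}. 2)"
    using fin w0 d by (subst sum.remove[of N w0]) auto
  finally have total: "(\<Sum>i\<in>K. card (?X i)) + 1 = 2 * card N"
    using fin w0 card_gt_0_iff[of N] by (cases "card N") auto
  have "\<exists>k\<in>K. card (?X k) = 1"
  proof (rule ccontr)
    assume none: "\<not> ?thesis"
    have "\<exists>j\<in>K. card (?X j) < 2"
    proof (rule ccontr)
      assume "\<not> ?thesis"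
      then have "(\<Sum>i\<in>K. 2) \<le> (\<Sum>i\<in>K. card (?X i))" by (intro sum_mono) auto
      then show False using total card by simp
    qed
    then obtain j where j: "j \<in> K" "card (?X j) = 0"
      using none by (metis One_nat_def less_2_cases)
    have "even (card (?X i))" if "i \<in> K" for i
    proof -
      have "card (?X i) \<le> 2" using balanced[OF that j(1)] j(2) by simp
      moreover have "card (?X i) \<noteq> 1" using none that by blast
      ultimately have "card (?X i) = 0 \<or> card (?X i) = 2" by linarith
      then show ?thesis by auto
    qed
    then have "even (\<Sum>i\<in>K. card (?X i))" by (rule dvd_sum)
    then show False using total by presburger
  qed
  then obtain k u where "k \<in> K" "?X k = {u}" by (auto simp: card_1_singleton_iff)
  then show ?thesis using that y by blast
qed

text \<open>This is Schrijver's form of the inductive step of Vizing's theorem. If some color k is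
  reserved at exactly one neighbor u of v, then v u receives color k, and the whole color
  class k can be put aside for the rest of the induction.\<close>

lemma extend_coloring_by_star:
  assumes "finite E" "\<And>e. e \<in> E \<Longrightarrow> card e = 2" "finite N" "finite K"
    and "v \<notin> \<Union>E" "v \<notin> N" "card N \<le> card K" "edge_coloring E K c"
    and "\<And>w. w \<in> N \<Longrightarrow> P w \<subseteq> K - colors_at E c w \<and> P w \<noteq> {}"
    and "\<And>w. w \<in> N \<Longrightarrow> w \<noteq> w0 \<Longrightarrow> 2 \<le> card (P w)"
  shows "\<exists>c'. edge_coloring (E \<union> (\<lambda>u. {v, u}) ` N) K c'"
  using assms
proof (induction "card N" arbitrary: N E K c P w0)
  case 0
  from "0.hyps" "0.prems"(3) have "N = {}" by simp
  with "0.prems"(8) show ?case by auto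
next
  case (Suc n)
  note E = Suc.prems(1,2) and fin = Suc.prems(3,4)
  \<comment> \<open>The vertex w0 may lie outside N, for instance if the previous step removed it;
    then any vertex of N can take the role of the one with a single reserved color.\<close>
  obtain w1 where w1: "w1 \<in> N" "w0 \<in> N \<Longrightarrow> w1 = w0"
    using Suc.hyps(2) by (metis card_eq_0_iff ex_in_conv nat.distinct(1))
  \<comment> \<open>The reserved sets are cut down to sizes with an odd sum, as
    \<open>exists_unique_holder\<close> requires.\<close>
  define d :: "'a \<Rightarrow> nat" where "d w = (if w = w1 then 1 else 2)" for w
  have "\<exists>Q. Q \<subseteq> P w \<and> card Q = d w" if "w \<in> N" for w
  proof -
    have "finite (P w)" using Suc.prems(9)[OF that] fin(2) by (meson Diff_subset finite_subset)
    then have "0 < card (P w)" using Suc.prems(9)[OF that] by (simp add: card_gt_0_iff)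
    then have "d w \<le> card (P w)"
      using Suc.prems(10)[OF that] w1 that by (auto simp: d_def)
    then show ?thesis by (meson obtain_subset_with_card_n)
  qed
  then obtain Q where Q: "\<And>w. w \<in> N \<Longrightarrow> Q w \<subseteq> P w \<and> card (Q w) = d w" by metis
  have "palette E K N d (c, Q)"
    using Q Suc.prems(8,9) by (fastforce simp: palette_def)
  then obtain c1 P1 k u where pal: "palette E K N d (c1, P1)" and k: "k \<in> K"
    and u: "holders N P1 k = {u}"
    using exists_unique_holder[OF E fin _ Suc.prems(7) w1(1)] d_def by metis
  have uN: "u \<in> N" and ku: "k \<in> P1 u" and other: "\<And>w. w \<in> N \<Longrightarrow> k \<in> P1 w \<Longrightarrow> w = u"
    using u by (auto simp: holders_def)
  have c1: "edge_coloring E K c1"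
    and P1: "\<And>w. w \<in> N \<Longrightarrow> P1 w \<subseteq> K - colors_at E c1 w" "\<And>w. w \<in> N \<Longrightarrow> card (P1 w) = d w"
    using pal by (auto simp: palette_def)
  \<comment> \<open>Only u holds k, so deleting the color k and its class leaves the other reserved
    sets valid. The vertex w1 remains the exceptional one, possibly equal to u.\<close>
  define F where "F = {e \<in> E. c1 e \<noteq> k}"
  have "\<exists>c'. edge_coloring (F \<union> (\<lambda>u. {v, u}) ` (N - {u})) (K - {k}) c'"
  proof (rule Suc.hyps(1)[of _ _ _ c1 P1 w1])
    show "n = card (N - {u})" "card (N - {u}) \<le> card (K - {k})"
      using Suc.hyps(2) Suc.prems(7) uN k fin by (auto simp: card_Diff_singleton_if)
    show "edge_coloring F (K - {k}) c1"
      using c1 by (auto simp: edge_coloring_def F_def inj_on_def)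
    show "P1 w \<subseteq> K - {k} - colors_at F c1 w \<and> P1 w \<noteq> {}" if w: "w \<in> N - {u}" for w
    proof -
      have "P1 w \<noteq> {}" using P1(2)[of w] w by (auto simp: d_def split: if_splits)
      moreover have "k \<notin> P1 w" using other w by blast
      moreover have "colors_at F c1 w \<subseteq> colors_at E c1 w"
        by (auto simp: colors_at_def F_def)
      ultimately show ?thesis using P1(1)[of w] w by blast
    qed
    show "2 \<le> card (P1 w)" if "w \<in> N - {u}" "w \<noteq> w1" for w
      using P1(2)[of w] that by (simp add: d_def)
  qed (use Suc.prems in \<open>auto simp: F_def\<close>)
  then obtain c2 where c2: "edge_coloring (F \<union> (\<lambda>u. {v, u}) ` (N - {u})) (K - {k}) c2" by blast
  define S where "S = F \<union> (\<lambda>u. {v, u}) ` (N - {u})"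
  \<comment> \<open>The class of k returns with the edge vu added to it, while S is colored without
    k.\<close>
  define M where "M = insert {v, u} {e \<in> E. c1 e = k}"
  define c3 where "c3 e = (if e \<in> S then c2 e else k)" for e
  have uv: "u \<noteq> v" using uN Suc.prems(6) by blast
  have vE: "v \<notin> e" if "e \<in> E" for e using that Suc.prems(5) by blast
  have SM: "E \<union> (\<lambda>u. {v, u}) ` N = S \<union> M"
    using uN by (auto simp: S_def M_def F_def)
  have disj: "S \<inter> M = {}"
    using uv vE by (auto simp: S_def M_def F_def doubleton_eq_iff)
  have cS: "c2 ` S \<subseteq> K - {k}" "inj_on c2 {e \<in> S. x \<in> e}" for x
    using c2 by (auto simp: S_def edge_coloring_def)
  \<comment> \<open>The color k is missing at u, and v lies on no edge of E, so vu meets no other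
    edge of the class.\<close>
  have matching: "e = e'" if "e \<in> M" "e' \<in> M" "x \<in> e" "x \<in> e'" for e e' x
  proof -
    have "k \<notin> colors_at E c1 u" using P1(1)[OF uN] ku by blast
    then have free: "u \<notin> f" if "f \<in> E" "c1 f = k" for f
      using that by (auto simp: colors_at_def)
    have "f = f'" if "f \<in> E" "f' \<in> E" "c1 f = k" "c1 f' = k" "x \<in> f" "x \<in> f'" for f f'
      using c1 that unfolding edge_coloring_def inj_on_def by blast
    then show ?thesis using that free vE by (auto simp: M_def)
  qed
  have "edge_coloring (S \<union> M) K c3"
    unfolding edge_coloring_def
  proof (intro conjI allI)
    show "c3 ` (S \<union> M) \<subseteq> K" using cS(1) k by (auto simp: c3_def)
    show "inj_on c3 {e \<in> S \<union> M. x \<in> e}" for x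
    proof (rule inj_onI)
      fix e e' assume *: "e \<in> {e \<in> S \<union> M. x \<in> e}" "e' \<in> {e \<in> S \<union> M. x \<in> e}" "c3 e = c3 e'"
      have "c2 f \<noteq> k" if "f \<in> S" for f using cS(1) that by blast
      then have "e \<in> S \<longleftrightarrow> e' \<in> S" using *(3) by (auto simp: c3_def split: if_splits)
      then show "e = e'"
        using * matching[of e e' x] inj_onD[OF cS(2)[of x], of e e'] by (auto simp: c3_def)
    qed
  qed
  then show ?case using SM by auto
qed

text \<open>Deleting v costs each of its neighbors one edge, so at least two colors of K are missing
  at every neighbor before v is put back by \<open>extend_coloring_by_star\<close>.\<close>

theorem vizing:
  assumes "simple_graph V E" "finite K" "\<And>v. v \<in> V \<Longrightarrow> degree E v < card K"
  shows "\<exists>c. edge_coloring E K c"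
proof -
  have "finite V" using assms(1) by (simp add: simple_graph_def)
  then show ?thesis using assms
  proof (induction V arbitrary: E)
    case empty
    then have "E = {}" by (fastforce simp: simple_graph_def)
    then show ?case by (auto simp: edge_coloring_def)
  next
    case (insert v V)
    have E: "\<And>e. e \<in> E \<Longrightarrow> e \<subseteq> insert v V" "\<And>e. e \<in> E \<Longrightarrow> card e = 2"
      using insert.prems(1) by (auto simp: simple_graph_def)
    have finE: "finite E"
      using E(1) insert.hyps(1) by (intro finite_subset[of E "Pow (insert v V)"]) auto
    define F where "F = {e \<in> E. v \<notin> e}"
    define N where "N = {u. {v, u} \<in> E}"
    have vN: "v \<notin> N" using E(2)[of "{v}"] by (auto simp: N_def)
    have NV: "N \<subseteq> V" using E(1) vN by (fastforce simp: N_def)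
    have finN: "finite N" using NV insert.hyps(1) by (rule finite_subset)
    have EF: "E = F \<union> (\<lambda>u. {v, u}) ` N"
    proof -
      have "e \<in> (\<lambda>u. {v, u}) ` N" if e: "e \<in> E" "v \<in> e" for e
      proof -
        obtain x y where "e = {x, y}" using E(2) e(1) by (meson card_2_iff)
        then show ?thesis using e by (auto simp: N_def insert_commute)
      qed
      then show ?thesis by (auto simp: F_def N_def)
    qed
    have F: "simple_graph V F"
      using E insert.hyps(1) by (fastforce simp: simple_graph_def F_def)
    have deg: "degree F w \<le> degree E w" for w
      unfolding degree_def F_def using finE by (intro card_mono) auto
    have degN: "degree F w < degree E w" if "w \<in> N" for w
      unfolding degree_def
    proof (rule psubset_card_mono)
      have "{v, w} \<in> {e \<in> E. w \<in> e}" "{v, w} \<notin> {e \<in> F. w \<in> e}"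
        using that by (simp_all add: F_def N_def)
      moreover have "{e \<in> F. w \<in> e} \<subseteq> {e \<in> E. w \<in> e}" by (auto simp: F_def)
      ultimately show "{e \<in> F. w \<in> e} \<subset> {e \<in> E. w \<in> e}" by blast
    qed (use finE in simp)
    have "\<exists>c. edge_coloring F K c"
      by (rule insert.IH[OF F insert.prems(2) le_less_trans[OF deg insert.prems(3)]]) simp
    then obtain c where c: "edge_coloring F K c" by blast
    have two: "2 \<le> card (K - colors_at F c w)" if "w \<in> N" for w
    proof -
      have "degree E w < card K" using insert.prems(3) NV that by blast
      moreover have "card (colors_at F c w) \<le> degree F w"
        unfolding colors_at_def degree_def using finE by (intro card_image_le) (auto simp: F_def)
      moreover have "card K - card (colors_at F c w) \<le> card (K - colors_at F c w)"
        using finE by (intro diff_card_le_card_Diff) (auto simp: colors_at_def F_def)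
      ultimately show ?thesis using degN[OF that] by linarith
    qed
    have "\<exists>c'. edge_coloring (F \<union> (\<lambda>u. {v, u}) ` N) K c'"
    proof (rule extend_coloring_by_star[where c = c and P = "\<lambda>w. K - colors_at F c w"])
      have "inj_on (\<lambda>u. {v, u}) N" by (auto simp: inj_on_def doubleton_eq_iff)
      then have "card N = card ((\<lambda>u. {v, u}) ` N)" by (simp add: card_image)
      also have "\<dots> \<le> degree E v"
        unfolding degree_def using finE by (intro card_mono) (auto simp: N_def)
      finally show "card N \<le> card K" using insert.prems(3)[of v] by simp
      show "K - colors_at F c w \<subseteq> K - colors_at F c w \<and> K - colors_at F c w \<noteq> {}" if "w \<in> N" for w
        using two[OF that] by (metis card.empty not_numeral_le_zero subset_refl)
    qed (use finE E finN insert.prems vN c two in \<open>auto simp: F_def\<close>)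
    then show ?case using EF by simp
  qed
qed

section \<open>Completing color sets by pendant edges\<close>

text \<open>Each color a in \<open>D v\<close> is supplied by one pendant edge at v of color a. A
  leaf sees a single color, which is an interval.\<close>

lemma cyclic_deficiency_le_sum:
  assumes V: "finite V" and E: "\<And>e. e \<in> E \<Longrightarrow> e \<subseteq> V" and t: "t \<ge> 1"
    and proper: "proper_edge_coloring E t \<alpha>"
    and D: "\<And>v. v \<in> V \<Longrightarrow> D v \<subseteq> {1..t} - colors_at E \<alpha> v"
    and cyc: "\<And>v. v \<in> V \<Longrightarrow> cyclic_interval t (colors_at E \<alpha> v \<union> D v)"
  shows "cyclic_deficiency V E \<le> (\<Sum>v\<in>V. card (D v))"
proof -
  define k where "k = (\<Sum>v\<in>V. card (D v))"
  have finD: "finite (D v)" if "v \<in> V" for v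
    using D[OF that] by (rule finite_subset) simp
  then have "finite (Sigma V D)" "card (Sigma V D) = k"
    using V by (simp_all add: k_def)
  \<comment> \<open>The bijection h enumerates the pairs of a vertex and an added color; the pendant
    edge with index i is attached at \<open>f i\<close> and gets color \<open>g i\<close>.\<close>
  then obtain h where h: "bij_betw h {..<k} (Sigma V D)"
    using ex_bij_betw_nat_finite by (metis lessThan_atLeast0)
  define f where "f i = fst (h i)" for i
  define g where "g i = snd (h i)" for i
  have fg: "f i \<in> V" "g i \<in> D (f i)" if "i < k" for i
    using bij_betw_apply[OF h, of i] that by (auto simp: f_def g_def)
  have inj: "i = j" if "i < k" "j < k" "f i = f j" "g i = g j" for i j
    using bij_betw_imp_inj_on[OF h] that by (auto simp: f_def g_def inj_on_def prod_eq_iff)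
  have surj: "\<exists>i<k. f i = v \<and> g i = a" if "v \<in> V" "a \<in> D v" for v a
  proof -
    have "(v, a) \<in> h ` {..<k}" using bij_betw_imp_surj_on[OF h] that by simp
    then obtain i where "i < k" "(v, a) = h i" by blast
    then show ?thesis by (intro exI[of _ i]) (simp add: f_def g_def flip: \<open>(v, a) = h i\<close>)
  qed
  \<comment> \<open>A pendant edge is recognized by its unique leaf \<open>Inr i\<close>; an old
    edge is pulled back along \<open>Inl\<close>.\<close>
  define \<beta> where "\<beta> x = (if \<exists>i. Inr i \<in> x then g (THE i. Inr i \<in> x) else \<alpha> (Inl -` x))" for x
  have old: "\<beta> (Inl ` e) = \<alpha> e" for e
    by (auto simp: \<beta>_def inj_vimage_image_eq)
  have pendant: "\<beta> {Inl v, Inr i} = g i" for v i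
    by (auto simp: \<beta>_def)
  let ?E = "attach_edges E k f"
  have D_disj: "a \<notin> D v" if "a \<in> colors_at E \<alpha> v" "v \<in> V" for a v
    using D[OF that(2)] that(1) by blast
  have edge: "(\<exists>e\<in>E. x = Inl ` e) \<or> (\<exists>i<k. x = {Inl (f i), Inr i})" if "x \<in> ?E" for x
    using that by (auto simp: attach_edges_def)
  have mixed: "\<alpha> e \<noteq> g i" if "e \<in> E" "i < k" "f i \<in> e" for e i
    using D_disj[of "\<alpha> e" "f i"] fg[OF that(2)] that by (auto simp: colors_at_def)
  have "proper_edge_coloring ?E t \<beta>"
    unfolding proper_edge_coloring_def
  proof (intro conjI ballI impI)
    fix x assume "x \<in> ?E"
    from edge[OF this] show "\<beta> x \<in> {1..t}"
    proof (elim disjE bexE exE conjE)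
      fix e assume "e \<in> E" "x = Inl ` e"
      then show ?thesis using proper old by (simp add: proper_edge_coloring_def)
    next
      fix i assume i: "i < k" "x = {Inl (f i), Inr i}"
      have "g i \<in> {1..t}" using fg[OF i(1)] D by blast
      then show ?thesis by (simp only: i(2) pendant)
    qed
  next
    fix x y assume x: "x \<in> ?E" and y: "y \<in> ?E" and xy: "x \<noteq> y \<and> x \<inter> y \<noteq> {}"
    from edge[OF x] edge[OF y] show "\<beta> x \<noteq> \<beta> y"
    proof (elim disjE bexE exE conjE)
      fix e e' assume *: "e \<in> E" "x = Inl ` e" "e' \<in> E" "y = Inl ` e'"
      then have "e \<noteq> e'" "e \<inter> e' \<noteq> {}" using xy by auto
      then show ?thesis using * proper by (simp add: old proper_edge_coloring_def)
    next
      fix e i assume *: "e \<in> E" "x = Inl ` e" "i < k" "y = {Inl (f i), Inr i}"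
      then have "f i \<in> e" using xy by auto
      then show ?thesis using * mixed[of e i] by (simp add: old pendant)
    next
      fix e i assume *: "e \<in> E" "y = Inl ` e" "i < k" "x = {Inl (f i), Inr i}"
      then have "f i \<in> e" using xy by auto
      then show ?thesis using * mixed[of e i] by (simp add: old pendant)
    next
      fix i j assume *: "i < k" "x = {Inl (f i), Inr i}" "j < k" "y = {Inl (f j), Inr j}"
      then have "i \<noteq> j" "f i = f j" using xy by auto
      then show ?thesis using * inj[of i j] by (auto simp: pendant)
    qed
  qed
  moreover have "cyclic_interval t (colors_at ?E \<beta> x)" if "x \<in> attach_verts V k" for x
  proof -
    from that consider v where "v \<in> V" "x = Inl v" | i where "i < k" "x = Inr i"
      by (auto simp: attach_verts_def)
    then show ?thesis
    proof cases
      case 1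
      have "{y \<in> ?E. Inl v \<in> y} =
          (`) Inl ` {e \<in> E. v \<in> e} \<union> (\<lambda>i. {Inl v, Inr i}) ` {i. i < k \<and> f i = v}"
        by (auto simp: attach_edges_def)
      then have "colors_at ?E \<beta> (Inl v) =
          \<alpha> ` {e \<in> E. v \<in> e} \<union> g ` {i. i < k \<and> f i = v}"
        by (simp add: colors_at_def image_Un image_image old pendant)
      also have "g ` {i. i < k \<and> f i = v} = D v"
        using fg surj[OF 1(1)] by fastforce
      finally show ?thesis using cyc[OF 1(1)] 1(2) by (simp add: colors_at_def)
    next
      case 2
      have "{y \<in> ?E. Inr i \<in> y} = {{Inl (f i), Inr i}}"
        using 2 by (auto simp: attach_edges_def)
      then have "colors_at ?E \<beta> x = {g i..g i}"
        using 2 by (simp add: colors_at_def pendant)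
      moreover have "g i \<in> {1..t}" using fg[OF 2(1)] D by blast
      moreover have "is_interval_nat {g i..g i}"
        unfolding is_interval_nat_def by blast
      ultimately show ?thesis
        by (simp add: cyclic_interval_def)
    qed
  qed
  ultimately have "cyclically_interval_colorable (attach_verts V k) ?E"
    using t by (auto simp: cyclically_interval_colorable_def cyclic_interval_coloring_def)
  then show ?thesis
    unfolding cyclic_deficiency_def k_def[symmetric]
    using fg by (intro Least_le exI[of _ f]) auto
qed

section \<open>Three cyclic orders of six colors\<close>

text \<open>An explicit list makes \<open>gap6\<close> computable. The case b = a - 1 contributes
  the empty interval.\<close>

definition cyclic_intervals6 :: "nat set list" where
  "cyclic_intervals6 =
     concat (map (\<lambda>I. [I, {1..6} - I]) [{a..b}. a \<leftarrow> [1..<7], b \<leftarrow> [a - 1..<7]])"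

definition gap6 :: "nat set \<Rightarrow> nat" where
  "gap6 S = Min (set (map (\<lambda>I. card (I - S)) (filter (\<lambda>I. S \<subseteq> I) cyclic_intervals6)))"

lemma cyclic_intervals6:
  assumes "I \<in> set cyclic_intervals6"
  shows "cyclic_interval 6 I"
proof -
  have int: "is_interval_nat {a..b}" for a b
    unfolding is_interval_nat_def by blast
  have "I \<subseteq> {1..6}" "I \<in> range (\<lambda>(a, b). {a..b}) \<or> {1..6} - I \<in> range (\<lambda>(a, b). {a..b})"
    using assms by (auto simp: cyclic_intervals6_def double_diff)
  then show ?thesis
    using int by (auto simp: cyclic_interval_def)
qed

lemma gap6_witness:
  assumes "S \<subseteq> {1..6}"
  shows "\<exists>D. D \<subseteq> {1..6} - S \<and> cyclic_interval 6 (S \<union> D) \<and> card D = gap6 S"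
proof -
  let ?F = "set (filter (\<lambda>I. S \<subseteq> I) cyclic_intervals6)"
  \<comment> \<open>The full color set contains S, so the minimum in \<open>gap6\<close> is taken
    over a nonempty set.\<close>
  have "{1..6} \<in> set cyclic_intervals6" by (force simp: cyclic_intervals6_def)
  then have "?F \<noteq> {}" using assms by auto
  then have "gap6 S \<in> (\<lambda>I. card (I - S)) ` ?F"
    unfolding gap6_def set_map by (intro Min_in) auto
  then obtain I where I: "I \<in> set cyclic_intervals6" "S \<subseteq> I" "gap6 S = card (I - S)" by auto
  then have "I \<subseteq> {1..6}" "cyclic_interval 6 I" "S \<union> (I - S) = I"
    using cyclic_intervals6[OF I(1)] by (auto simp: cyclic_interval_def)
  then show ?thesis using I(3) by (intro exI[of _ "I - S"]) auto
qed

text \<open>These three orders were found by computer search; no two orders bring the average gap of every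
  set down to 1.\<close>

definition orders6 :: "nat list list" where
  "orders6 = [[1,2,3,4,5,6], [1,2,4,6,3,5], [1,4,6,3,2,5]]"

text \<open>A sum of 3 over three orders is an average gap of 1. There are only 64 sets S, and each
  is checked by evaluation.\<close>

lemma gap6_average:
  assumes "S \<subseteq> {0..<6}"
  shows "(\<Sum>p\<leftarrow>orders6. gap6 ((!) p ` S)) \<le> 3"
proof -
  have "\<forall>S\<in>set (map set (subseqs [0..<6])). (\<Sum>p\<leftarrow>orders6. gap6 ((!) p ` S)) \<le> 3"
    by code_simp
  moreover have "S \<in> set (map set (subseqs [0..<6]))"
    using assms subseqs_powset[of "[0..<6]"] by auto
  ultimately show ?thesis by blast
qed

lemma orders6_permutation:
  assumes "p \<in> set orders6"
  shows "distinct p" "length p = 6" "set p = {1..6}"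
proof -
  show p: "distinct p" "length p = 6"
    using assms by (auto simp: orders6_def)
  have "set p \<subseteq> {1..6}"
    using assms by (auto simp: orders6_def)
  moreover have "card (set p) = card {1..6::nat}"
    using p by (simp add: distinct_card)
  ultimately show "set p = {1..6}"
    by (simp add: card_subset_eq)
qed

section \<open>The bound on the cyclic deficiency\<close>

theorem theorem14:
  fixes V :: "'a set" and E :: "'a set set"
  assumes "simple_graph V E"
    and "max_degree V E \<le> 5"
  shows "cyclic_deficiency V E \<le> card V"
proof -
  have V: "finite V" and E: "\<And>e. e \<in> E \<Longrightarrow> e \<subseteq> V"
    using assms(1) by (auto simp: simple_graph_def)
  have "degree E v \<le> 5" if "v \<in> V" for v
  proof -
    have "degree E v \<le> max_degree V E"
      unfolding max_degree_def using V that by (intro Max_ge) auto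
    then show ?thesis using assms(2) by simp
  qed
  \<comment> \<open>Six colors exceed every degree. They start at 0 because they serve as indices
    into the lists of \<open>orders6\<close>, whose entries are the final colors 1 to 6.\<close>
  then obtain c where c: "edge_coloring E {0..<6} c"
    using vizing[OF assms(1), of "{0..<6}"] by fastforce
  define \<alpha> where "\<alpha> p e = p ! c e" for p :: "nat list" and e
  have colors: "colors_at E (\<alpha> p) v = (!) p ` colors_at E c v" for p v
    by (simp add: colors_at_def \<alpha>_def image_image)
  have c6: "c e < 6" if "e \<in> E" for e
    using c that by (auto simp: edge_coloring_def)
  define total where "total p = (\<Sum>v\<in>V. gap6 (colors_at E (\<alpha> p) v))" for p
  have bound: "cyclic_deficiency V E \<le> total p" if p: "p \<in> set orders6" for p
  proof -
    note perm = orders6_permutation[OF p]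
    have range: "\<alpha> p e \<in> {1..6}" if "e \<in> E" for e
      using c6[OF that] perm nth_mem[of "c e" p] by (simp add: \<alpha>_def)
    then have "colors_at E (\<alpha> p) v \<subseteq> {1..6}" for v
      by (auto simp: colors_at_def)
    then have "\<exists>D. D \<subseteq> {1..6} - colors_at E (\<alpha> p) v \<and>
        cyclic_interval 6 (colors_at E (\<alpha> p) v \<union> D) \<and> card D = gap6 (colors_at E (\<alpha> p) v)" for v
      by (rule gap6_witness)
    then obtain D where D: "\<And>v. D v \<subseteq> {1..6} - colors_at E (\<alpha> p) v \<and>
        cyclic_interval 6 (colors_at E (\<alpha> p) v \<union> D v) \<and> card (D v) = gap6 (colors_at E (\<alpha> p) v)"
      by metis
    have proper: "proper_edge_coloring E 6 (\<alpha> p)"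
      unfolding proper_edge_coloring_def
    proof (intro conjI ballI impI)
      fix e e' assume *: "e \<in> E" "e' \<in> E" "e \<noteq> e' \<and> e \<inter> e' \<noteq> {}"
      then obtain v where "v \<in> e" "v \<in> e'" by blast
      then have "c e \<noteq> c e'"
        using c * unfolding edge_coloring_def inj_on_def by blast
      then show "\<alpha> p e \<noteq> \<alpha> p e'"
        using c6[of e] c6[of e'] * perm by (simp add: \<alpha>_def nth_eq_iff_index_eq)
    qed (rule range)
    have "cyclic_deficiency V E \<le> (\<Sum>v\<in>V. card (D v))"
      by (rule cyclic_deficiency_le_sum[OF V E _ proper]) (use D in auto)
    then show ?thesis by (simp add: D total_def)
  qed
  have "(\<Sum>p\<leftarrow>orders6. gap6 (colors_at E (\<alpha> p) v)) \<le> 3" for v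
  proof -
    have "colors_at E c v \<subseteq> {0..<6}" using c6 by (auto simp: colors_at_def)
    from gap6_average[OF this] show ?thesis by (simp only: colors)
  qed
  \<comment> \<open>Exchanging the sums shows that the three totals add up to at most 3|V|, so one
    of them is at most |V|.\<close>
  then have "(\<Sum>v\<in>V. \<Sum>p\<leftarrow>orders6. gap6 (colors_at E (\<alpha> p) v)) \<le> (\<Sum>v\<in>V. 3)"
    by (intro sum_mono)
  then have "(\<Sum>p\<leftarrow>orders6. total p) \<le> 3 * card V"
    by (simp add: orders6_def total_def sum.distrib)
  then have "\<exists>p\<in>set orders6. total p \<le> card V"
    unfolding orders6_def by simp linarith
  then show ?thesis using bound le_trans by blast
qed

end
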